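(* Let $t\ge 2$ be an integer and $r=2^t-1$ (so $t=\log_2(r+1)$). There exists an $r$-uniform $r$-partite $2^{t-1}$-regular hypergraph with exactly two vertices in each part that has no $(t-1)$-shallow hitting edge set.
   Context: A hypergraph $H=(V,E)$ has a finite vertex set and a finite multiset of edges (subsets of $V$). $H$ is $r$-uniform if each edge has $r$ vertices; $r$-partite if $V$ can be partitioned into $r$ parts such that every edge meets each part in at most one vertex (a fixed such partition is considered, whose members are the parts); $d$-regular if every vertex lies in exactly $d$ edges. For $M\subseteq E$, $\deg_M(v)$ is the number of edges of $M$ containing $v$; $M$ is hitting if $\deg_M(v)\ge1$ for all $v$ and $s$-shallow if $\deg_M(v)\le s$ for all $v$. *)

theory Defs
  imports Main "HOL-Library.Multiset" "HOL-Library.Disjoint_Sets"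
begin

definition hypergraph :: "'a set \<Rightarrow> 'a set multiset \<Rightarrow> bool" where
  "hypergraph V E \<longleftrightarrow> finite V \<and> (\<forall>e\<in>#E. e \<subseteq> V)"

definition uniform :: "nat \<Rightarrow> 'a set multiset \<Rightarrow> bool" where
  "uniform r E \<longleftrightarrow> (\<forall>e\<in>#E. card e = r)"

text \<open>
  \<open>P\<close> is the fixed partition of the vertex set that witnesses \<open>r\<close>-partiteness; its members are
  the parts (nonempty, as always for \<^const>\<open>partition_on\<close>).
\<close>
definition partite_with :: "nat \<Rightarrow> 'a set \<Rightarrow> 'a set multiset \<Rightarrow> 'a set set \<Rightarrow> bool" where
  "partite_with r V E P \<longleftrightarrow>
     partition_on V P \<and> finite P \<and> card P = r \<and> (\<forall>e\<in>#E. \<forall>p\<in>P. card (e \<inter> p) \<le> 1)"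

text \<open>
  Edge sets \<open>M\<close> of a hypergraph with edge multiset \<open>E\<close> are submultisets \<open>M \<subseteq># E\<close>, and degrees
  count parallel edges with multiplicity.
\<close>
definition degree :: "'a set multiset \<Rightarrow> 'a \<Rightarrow> nat" where
  "degree M v = size {#e \<in># M. v \<in> e#}"

definition regular :: "nat \<Rightarrow> 'a set \<Rightarrow> 'a set multiset \<Rightarrow> bool" where
  "regular d V E \<longleftrightarrow> (\<forall>v\<in>V. degree E v = d)"

definition hitting :: "'a set \<Rightarrow> 'a set multiset \<Rightarrow> bool" where
  "hitting V M \<longleftrightarrow> (\<forall>v\<in>V. degree M v \<ge> 1)"

definition shallow :: "nat \<Rightarrow> 'a set \<Rightarrow> 'a set multiset \<Rightarrow> bool" where
  "shallow s V M \<longleftrightarrow> (\<forall>v\<in>V. degree M v \<le> s)"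

end

theory Submission
  imports Defs "HOL-Library.Nat_Bijection"
begin

text \<open>
  The edges are the points \<open>x\<close> of \<open>F\<^sub>2\<^sup>t\<close>, the parts are the nonzero linear functionals \<open>f\<close>, and the
  vertices are the pairs \<open>(f, b)\<close>, where \<open>(f, b)\<close> lies on \<open>x\<close> iff \<open>f x = b\<close>. A hitting edge set is a
  set of points on which no nonzero functional is constant. A minimal such set \<open>Y\<close> has at least
  \<open>t + 1\<close> points, since distinct functionals have distinct restrictions to \<open>Y\<close>, even modulo constants. By
  minimality, every indicator function of a point of \<open>Y\<close>, hence every function on \<open>Y\<close>, is the
  restriction of an affine functional. So some functional is constant on all of \<open>Y\<close> but one
  point, where it differs, and therefore takes some value at least \<open>t\<close> times.
\<close>

section \<open>The bilinear form over F_2\<close>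

text \<open>
  Points and functionals are both given by subsets of an index set of size \<open>t\<close>; this is the
  standard bilinear form.
\<close>
definition pairing :: "'a set \<Rightarrow> 'a set \<Rightarrow> bool" where
  "pairing S x \<longleftrightarrow> odd (card (S \<inter> x))"

lemma pairing_commute: "pairing S x = pairing x S"
  by (simp add: pairing_def Int_commute)

lemma pairing_empty [simp]: "\<not> pairing {} x"
  by (simp add: pairing_def)

lemma odd_card_sym_diff:
  assumes "finite A" "finite B"
  shows "odd (card (sym_diff A B)) \<longleftrightarrow> odd (card A) \<noteq> odd (card B)"
proof -
  have "card (sym_diff A B) = card (A - B) + card (B - A)"
    using assms by (intro card_Un_disjoint) auto
  moreover have "card A = card (A - B) + card (A \<inter> B)" "card B = card (B - A) + card (A \<inter> B)"
    using assms by (metis card_Int_Diff add.commute Int_commute)+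
  ultimately show ?thesis by auto
qed

text \<open>Symmetric difference is vector addition and \<open>\<noteq>\<close> is addition of bits,
  so this is additivity of the form.\<close>

lemma pairing_sym_diff:
  assumes "finite S" "finite T"
  shows "pairing (sym_diff S T) x \<longleftrightarrow> pairing S x \<noteq> pairing T x"
proof -
  have "sym_diff S T \<inter> x = sym_diff (S \<inter> x) (T \<inter> x)" by auto
  then show ?thesis
    using assms odd_card_sym_diff[of "S \<inter> x" "T \<inter> x"] by (simp add: pairing_def)
qed

text \<open>Toggling a fixed \<open>i \<in> S\<close> flips the parity, so an involution swaps the
  two fibres and each is half of \<open>Pow I\<close>. This yields regularity.\<close>

lemma card_pairing_eq:
  assumes "finite I" "S \<subseteq> I" "S \<noteq> {}"
  shows "card {x \<in> Pow I. pairing S x = b} = 2 ^ (card I - 1)"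
proof -
  obtain i where i: "i \<in> S" using assms by blast
  have finS: "finite S" using assms finite_subset by blast
  let ?f = "\<lambda>x. sym_diff x {i}"
  have flip: "pairing S (?f x) \<longleftrightarrow> \<not> pairing S x" if "x \<subseteq> I" for x
  proof -
    have "finite x" using that assms finite_subset by blast
    then have "pairing (?f x) S \<longleftrightarrow> pairing x S \<noteq> pairing {i} S"
      by (intro pairing_sym_diff) auto
    moreover have "pairing {i} S" using i by (simp add: pairing_def)
    ultimately show ?thesis by (metis pairing_commute)
  qed
  have sub: "?f x \<subseteq> I" if "x \<subseteq> I" for x using that i assms by auto
  have inv: "?f (?f x) = x" for x by auto
  have "bij_betw ?f {x \<in> Pow I. pairing S x = b} {x \<in> Pow I. pairing S x = (\<not> b)}"
    by (rule bij_betw_byWitness[where f' = ?f]) (use flip sub inv in auto)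
  then have eq: "card {x \<in> Pow I. pairing S x = b} = card {x \<in> Pow I. pairing S x = (\<not> b)}"
    by (rule bij_betw_same_card)
  have "card (Pow I) = card ({x \<in> Pow I. pairing S x = b} \<union> {x \<in> Pow I. pairing S x = (\<not> b)})"
    by (rule arg_cong[where f = card]) auto
  also have "\<dots> = card {x \<in> Pow I. pairing S x = b} + card {x \<in> Pow I. pairing S x = (\<not> b)}"
    using assms by (intro card_Un_disjoint) auto
  finally have "2 * card {x \<in> Pow I. pairing S x = b} = 2 ^ card I"
    using eq assms by (simp add: card_Pow)
  moreover have "card I > 0" using assms card_gt_0_iff by blast
  ultimately show ?thesis by (cases "card I") auto
qed

section \<open>Separating sets of points\<close>

text \<open>For finite \<open>I\<close>: the traces of \<open>X\<close> on \<open>I\<close> lie in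
  no common affine hyperplane.\<close>

definition separating :: "'a set \<Rightarrow> 'a set set \<Rightarrow> bool" where
  "separating I X \<longleftrightarrow> (\<forall>S \<in> Pow I - {{}}. \<forall>b. \<exists>x \<in> X. pairing S x = b)"

text \<open>Recording where a functional differs from its value at a base point \<open>x\<close>
  forgets constants; this embeds \<open>Pow I\<close> into \<open>Pow (X - {x})\<close>. For empty
  \<open>I\<close>, \<open>X\<close> could be empty and the strict bound would fail.\<close>

lemma separating_card:
  assumes "finite I" "I \<noteq> {}" "finite X" "separating I X"
  shows "card I < card X"
proof -
  have "I \<in> Pow I - {{}}" using assms by simp
  then obtain x where x: "x \<in> X" using assms(4) unfolding separating_def by blast
  let ?g = "\<lambda>S. {y \<in> X. pairing S y \<noteq> pairing S x}"
  have "inj_on ?g (Pow I)"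
  proof (rule inj_onI)
    fix S T assume ST: "S \<in> Pow I" "T \<in> Pow I" and eq: "?g S = ?g T"
    have fin: "finite S" "finite T" using ST assms finite_subset by blast+
    have "pairing (sym_diff S T) y = pairing (sym_diff S T) x" if "y \<in> X" for y
    proof -
      have "y \<in> ?g S \<longleftrightarrow> y \<in> ?g T" by (simp only: eq)
      then show ?thesis using that fin by (auto simp: pairing_sym_diff)
    qed
    then have "\<not> (\<exists>y \<in> X. pairing (sym_diff S T) y = (\<not> pairing (sym_diff S T) x))" by auto
    then have "sym_diff S T = {}"
      using assms(4) ST unfolding separating_def by blast
    then show "S = T" by auto
  qed
  moreover have "?g ` Pow I \<subseteq> Pow (X - {x})" by auto
  ultimately have "card (Pow I) \<le> card (Pow (X - {x}))"
    using assms by (intro card_inj_on_le) auto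
  then have "card I \<le> card X - 1"
    using assms x by (simp add: card_Pow)
  moreover have "card X > 0" using x assms card_gt_0_iff by blast
  ultimately show ?thesis by linarith
qed

lemma affine_functional_indicator:
  assumes I: "finite I" and Y: "finite Y" "separating I Y"
    and minimal: "\<And>y. y \<in> Y \<Longrightarrow> \<not> separating I (Y - {y})"
    and A: "A \<subseteq> Y"
  shows "\<exists>S c. S \<subseteq> I \<and> (\<forall>y \<in> Y. y \<in> A \<longleftrightarrow> pairing S y \<noteq> c)"
proof -
  have "finite A" using A Y finite_subset by blast
  then show ?thesis using A
  proof (induction A)
    case empty
    show ?case by (intro exI[of _ "{}"] exI[of _ False]) auto
  next
    case (insert a A)
    then obtain S c where S: "S \<subseteq> I" "\<forall>y \<in> Y. y \<in> A \<longleftrightarrow> pairing S y \<noteq> c" by auto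
    \<comment> \<open>Without \<open>a\<close> some nonzero functional \<open>T\<close> misses a
      value \<open>d\<close>; on all of \<open>Y\<close> it takes \<open>d\<close>, hence exactly at
      \<open>a\<close>.\<close>
    obtain T d where T: "T \<subseteq> I" "T \<noteq> {}" "\<forall>y \<in> Y - {a}. pairing T y \<noteq> d"
      using minimal[of a] insert.prems unfolding separating_def by auto
    then have Ta: "pairing T a = d"
      using Y(2) unfolding separating_def by (metis DiffI PowI singletonD)
    have fin: "finite S" "finite T" using S T I finite_subset by blast+
    \<comment> \<open>Add the indicators \<open>S + c\<close> of \<open>A\<close> and
      \<open>T + d + 1\<close> of \<open>a\<close>; the constants sum to \<open>c + d + 1\<close>,
      which is the bit \<open>c = d\<close>.\<close>
    have "y \<in> insert a A \<longleftrightarrow> pairing (sym_diff S T) y \<noteq> (c = d)" if "y \<in> Y" for y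
      using that S(2) T(3) Ta insert.hyps fin by (cases "y = a") (auto simp: pairing_sym_diff)
    moreover have "sym_diff S T \<subseteq> I" using S T by auto
    ultimately show ?case by blast
  qed
qed

lemma separating_imp_large_fibre:
  assumes I: "finite I" "I \<noteq> {}" and X: "finite X" "separating I X"
  shows "\<exists>S \<in> Pow I - {{}}. \<exists>b. card I \<le> card {x \<in> X. pairing S x = b}"
proof -
  obtain Y where Y: "Y \<subseteq> X" "separating I Y"
    and least: "\<And>Z. Z \<subseteq> X \<Longrightarrow> separating I Z \<Longrightarrow> card Y \<le> card Z"
    using ex_has_least_nat[of "\<lambda>Y. Y \<subseteq> X \<and> separating I Y" X card] X by auto
  have finY: "finite Y" using Y X finite_subset by blast
  have minimal: "\<not> separating I (Y - {y})" if "y \<in> Y" for y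
    using least[of "Y - {y}"] Y that finY card_Diff1_less[of Y y] by fastforce
  have card: "card I < card Y" using separating_card I finY Y by blast
  have "card I > 0" using I by (simp add: card_gt_0_iff)
  then obtain a where a: "a \<in> Y" using card by fastforce
  obtain S c where S: "S \<subseteq> I" "\<forall>y \<in> Y. y \<in> Y - {a} \<longleftrightarrow> pairing S y \<noteq> c"
    using affine_functional_indicator[of I Y "Y - {a}"] I finY Y minimal by blast
  have cardD: "card (Y - {a}) = card Y - 1" using a finY by simp
  then have "card (Y - {a}) > 0" using card \<open>card I > 0\<close> by linarith
  \<comment> \<open>\<open>S\<close> takes different values at \<open>a\<close> and
    \<open>b\<close>, so it is not the zero functional.\<close>
  then obtain b where b: "b \<in> Y - {a}" by (metis card.empty ex_in_conv less_irrefl)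
  then have "S \<noteq> {}" using S(2) a pairing_empty by blast
  moreover have "card (Y - {a}) \<le> card {x \<in> X. pairing S x = (\<not> c)}"
    using S Y X by (intro card_mono) auto
  ultimately show ?thesis using S card cardD
    by (intro bexI[of _ S] exI[of _ "\<not> c"]) auto
qed

section \<open>The hypergraph on natural numbers\<close>

text \<open>The pair \<open>(S, b)\<close> coded as a number; \<open>set_encode\<close> is injective
  only on finite sets.\<close>

definition vert :: "nat set \<Rightarrow> bool \<Rightarrow> nat" where
  "vert S b = prod_encode (set_encode S, of_bool b)"

lemma vert_eq_iff [simp]:
  assumes "finite S" "finite T"
  shows "vert S b = vert T c \<longleftrightarrow> S = T \<and> b = c"
  using assms by (auto simp: vert_def set_encode_eq)

definition functionals :: "nat \<Rightarrow> nat set set" where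
  "functionals t = Pow {..<t} - {{}}"

definition edge :: "nat \<Rightarrow> nat set \<Rightarrow> nat set" where
  "edge t x = (\<lambda>S. vert S (pairing S x)) ` functionals t"

lemma finite_functionals [simp]: "finite (functionals t)"
  by (simp add: functionals_def)

lemma functionals_finite: "S \<in> functionals t \<Longrightarrow> finite S"
  unfolding functionals_def using finite_subset by blast

lemma card_functionals: "card (functionals t) = 2 ^ t - 1"
  by (simp add: functionals_def card_Pow)

lemma vert_in_edge_iff:
  assumes "S \<in> functionals t"
  shows "vert S b \<in> edge t x \<longleftrightarrow> pairing S x = b"
  using assms by (auto simp: edge_def functionals_finite)

lemma degree_image_mset_set:
  assumes "finite X"
  shows "degree (image_mset f (mset_set X)) v = card {x \<in> X. v \<in> f x}"
  using assms by (simp add: degree_def filter_mset_image_mset filter_mset_mset_set)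

text \<open>Lets an edge multiset be replaced by a set of points, even if \<open>f\<close>
  identifies points: by induction, the new point is selected iff its image still occurs in
  \<open>M\<close>.\<close>

lemma subseteq_image_mset_set:
  assumes "finite X" "M \<subseteq># image_mset f (mset_set X)"
  shows "\<exists>Y \<subseteq> X. M = image_mset f (mset_set Y)"
  using assms
proof (induction X arbitrary: M)
  case empty
  then show ?case by simp
next
  case (insert a X)
  show ?case
  proof (cases "f a \<in># M")
    case True
    then obtain N where N: "M = add_mset (f a) N" by (meson mset_add)
    then obtain Y where Y: "Y \<subseteq> X" "N = image_mset f (mset_set Y)"
      using insert by auto
    moreover have "finite Y" "a \<notin> Y" using Y insert finite_subset by blast+
    ultimately show ?thesis using N by (intro exI[of _ "insert a Y"]) auto
  next
    case False
    then have "M \<subseteq># image_mset f (mset_set X)"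
      using insert subset_eq_diff_conv[of M "{#f a#}" "image_mset f (mset_set X)"]
      by (simp add: diff_single_trivial)
    then show ?thesis using insert.IH by blast
  qed
qed

theorem theorem2p13:
  fixes t r :: nat
  assumes "t \<ge> 2" and "r = 2 ^ t - 1"
  shows "\<exists>(V :: nat set) E P.
           hypergraph V E \<and> uniform r E \<and> partite_with r V E P \<and>
           regular (2 ^ (t - 1)) V E \<and> (\<forall>p\<in>P. card p = 2) \<and>
           \<not> (\<exists>M. M \<subseteq># E \<and> hitting V M \<and> shallow (t - 1) V M)"
proof -
  let ?F = "functionals t"
  let ?part = "\<lambda>S. {vert S False, vert S True}"
  define P where "P = ?part ` ?F"
  define V where "V = \<Union> P"
  define E where "E = image_mset (edge t) (mset_set (Pow {..<t}))"
  have V_iff: "v \<in> V \<longleftrightarrow> (\<exists>S \<in> ?F. \<exists>b. v = vert S b)" for v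
    by (auto simp: V_def P_def ex_bool_eq)
  have fin: "finite S" if "S \<in> ?F" for S using that by (rule functionals_finite)
  have "hypergraph V E"
  proof -
    have "edge t x \<subseteq> V" for x
      unfolding edge_def using V_iff by blast
    moreover have "finite V" by (auto simp: V_def P_def)
    ultimately show ?thesis by (auto simp: hypergraph_def E_def)
  qed
  moreover have "uniform r E"
  proof -
    have "card (edge t x) = r" for x
      unfolding edge_def assms(2) card_functionals[symmetric]
      \<comment> \<open>\<open>S\<close> can be read off \<open>vert S b\<close>, so an edge has one
        vertex per functional.\<close>
      by (rule card_image) (auto simp: inj_on_def fin)
    then show ?thesis by (auto simp: uniform_def E_def)
  qed
  moreover have "partite_with r V E P"
  proof -
    have "inj_on ?part ?F" by (auto simp: inj_on_def fin doubleton_eq_iff)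
    then have "card P = r" by (simp add: P_def card_image card_functionals assms(2))
    moreover have "partition_on V P"
      by (rule partition_onI) (auto simp: V_def P_def disjnt_def fin)
    moreover have "card (edge t x \<inter> p) \<le> 1" if p: "p \<in> P" for x p
    proof -
      obtain S where S: "S \<in> ?F" "p = ?part S" using p unfolding P_def by blast
      then have "edge t x \<inter> p \<subseteq> {vert S (pairing S x)}"
        by (auto simp: vert_in_edge_iff)
      then have "card (edge t x \<inter> p) \<le> card {vert S (pairing S x)}"
        by (intro card_mono) simp_all
      then show ?thesis by simp
    qed
    ultimately show ?thesis by (simp add: partite_with_def E_def P_def)
  qed
  moreover have "regular (2 ^ (t - 1)) V E"
    unfolding regular_def
  proof
    fix v assume "v \<in> V"
    then obtain S b where S: "S \<in> ?F" "v = vert S b" by (auto simp: V_iff)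
    then show "degree E v = 2 ^ (t - 1)"
      using card_pairing_eq[of "{..<t}" S b]
      by (simp add: E_def degree_image_mset_set vert_in_edge_iff) (simp add: functionals_def)
  qed
  moreover have "\<forall>p\<in>P. card p = 2"
    by (auto simp: P_def fin)
  moreover have "\<not> (hitting V M \<and> shallow (t - 1) V M)" if "M \<subseteq># E" for M
  proof
    assume M: "hitting V M \<and> shallow (t - 1) V M"
    obtain X where X: "X \<subseteq> Pow {..<t}" "M = image_mset (edge t) (mset_set X)"
      using subseteq_image_mset_set[of "Pow {..<t}" M "edge t"] \<open>M \<subseteq># E\<close> by (auto simp: E_def)
    have finX: "finite X" using X finite_subset by blast
    \<comment> \<open>Degrees are fibre sizes: hitting makes \<open>X\<close> separating, and
      shallowness bounds every fibre by \<open>t - 1\<close>.\<close>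
    have deg: "degree M (vert S b) = card {x \<in> X. pairing S x = b}" if "S \<in> ?F" for S b
      using that finX by (simp add: X degree_image_mset_set vert_in_edge_iff)
    have in_V: "vert S b \<in> V" if "S \<in> ?F" for S b using that V_iff by blast
    have "\<exists>x \<in> X. pairing S x = b" if "S \<in> ?F" for S b
    proof -
      have "1 \<le> degree M (vert S b)" using M in_V[OF that] by (simp add: hitting_def)
      then have "card {x \<in> X. pairing S x = b} > 0" by (simp add: deg[OF that])
      then show ?thesis by (auto simp: card_gt_0_iff)
    qed
    then have "separating {..<t} X" by (auto simp: separating_def functionals_def)
    then obtain S b where S: "S \<in> ?F" "t \<le> card {x \<in> X. pairing S x = b}"
      using separating_imp_large_fibre[of "{..<t}" X] finX assms(1)
      by (auto simp: functionals_def lessThan_empty_iff)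
    have "degree M (vert S b) \<le> t - 1" using M in_V[OF S(1)] by (simp add: shallow_def)
    then have "t \<le> t - 1" using S(2) deg[OF S(1)] by simp
    then show False using assms(1) by simp
  qed
  ultimately show ?thesis by blast
qed

end
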